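(* Let $d,k,n$ be positive integers with $1\leq d\leq \lfloor n/2\rfloor$ and $2\leq k\leq \lfloor n/2\rfloor+1$, and let $C_n$ be the cycle with vertex set $\{0,\ldots,n-1\}$ and edges $\{i,(i+1)\bmod n\}$ for $0\le i\le n-1$. Then \[\mathrm{gp}^k_d(C_n)=\begin{cases} n & \text{if } 1\leq d\leq k-2,\\ \left\lfloor\frac{(k-1)n}{d+1}\right\rfloor & \text{if } k-1\leq d\leq \lfloor n/2\rfloor.\end{cases}\]
   Context: For a graph $G$, a geodesic of $G$ is a shortest path between two vertices of $G$; its length $\lambda(g)$ is its number of edges and $V(g)$ is its vertex set. For integers $d\ge1$, $k\ge2$, a set $S\subseteq V(G)$ is a $k$-general $d$-position set in $G$ if for every geodesic $g$ of $G$, $|S\cap V(g)|\geq k$ implies $\lambda(g)>d$. The $k$-general $d$-position number $\mathrm{gp}^k_d(G)$ is the largest cardinality of a $k$-general $d$-position set in $G$. *)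

theory Defs
  imports Main
begin

text \<open>An undirected graph is a pair of a vertex set and a set of edges, where an edge is the set
  of its two end vertices.\<close>

type_synonym 'a graph = "'a set \<times> 'a set set"

abbreviation verts :: "'a graph \<Rightarrow> 'a set" where
  "verts G \<equiv> fst G"

abbreviation edges :: "'a graph \<Rightarrow> 'a set set" where
  "edges G \<equiv> snd G"

text \<open>Paths are given by their nonempty list of vertices. The trivial path with a single vertex
  is included.\<close>

definition path :: "'a graph \<Rightarrow> 'a list \<Rightarrow> bool" where
  "path G p \<longleftrightarrow> p \<noteq> [] \<and> set p \<subseteq> verts G \<and> distinct p \<and>
     successively (\<lambda>u v. {u, v} \<in> edges G) p"

definition path_length :: "'a list \<Rightarrow> nat" where
  "path_length p = length p - 1"

definition geodesic :: "'a graph \<Rightarrow> 'a list \<Rightarrow> bool" where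
  "geodesic G g \<longleftrightarrow> path G g \<and>
     (\<forall>p. path G p \<and> hd p = hd g \<and> last p = last g \<longrightarrow> path_length g \<le> path_length p)"

definition general_position_set :: "nat \<Rightarrow> nat \<Rightarrow> 'a graph \<Rightarrow> 'a set \<Rightarrow> bool" where
  "general_position_set k d G S \<longleftrightarrow> S \<subseteq> verts G \<and>
     (\<forall>g. geodesic G g \<longrightarrow> card (S \<inter> set g) \<ge> k \<longrightarrow> path_length g > d)"

text \<open>For a finite graph and \<open>k > 0\<close> the maximum is over a finite set that contains
  \<open>card {}\<close>, so it is attained.\<close>

definition gp :: "nat \<Rightarrow> nat \<Rightarrow> 'a graph \<Rightarrow> nat" where
  "gp k d G = Max {card S | S. general_position_set k d G S}"

lemma gp_attained:
  assumes "finite (verts G)" and "k > 0"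
  shows "\<exists>S. general_position_set k d G S \<and> card S = gp k d G"
    and "\<And>S. general_position_set k d G S \<Longrightarrow> card S \<le> gp k d G"
proof -
  let ?A = "{card S | S. general_position_set k d G S}"
  have "?A \<subseteq> card ` Pow (verts G)"
    by (auto simp: general_position_set_def)
  then have fin: "finite ?A"
    using assms(1) by (meson finite_Pow_iff finite_imageI finite_subset)
  have "general_position_set k d G {}"
    using assms(2) by (simp add: general_position_set_def)
  then have "?A \<noteq> {}" by blast
  from Max_in[OF fin this] show "\<exists>S. general_position_set k d G S \<and> card S = gp k d G"
    unfolding gp_def by force
  show "card S \<le> gp k d G" if "general_position_set k d G S" for S
    unfolding gp_def using that by (intro Max_ge[OF fin]) blast
qed

text \<open>For \<open>n = 2\<close> this is the single edge \<open>{0, 1}\<close>.\<close>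

definition cycle_graph :: "nat \<Rightarrow> nat graph" where
  "cycle_graph n = ({0..<n}, {{i, (i + 1) mod n} | i. i < n})"

end

theory Submission
  imports Defs
begin

text \<open>A geodesic of length at most \<open>d\<close> in the cycle lies in an arc of \<open>d + 1\<close> consecutive
  vertices, and such an arc is itself a geodesic because \<open>d \<le> n div 2\<close>. So \<open>S\<close> is a general
  position set iff every arc of \<open>d + 1\<close> vertices meets it in fewer than \<open>k\<close> vertices. Summing
  over all \<open>n\<close> arcs counts every vertex of \<open>S\<close> exactly \<open>d + 1\<close> times, which yields the upper
  bound. It is attained by the balanced set of the \<open>i\<close> at which \<open>\<lfloor>i m / n\<rfloor>\<close> jumps, where \<open>m\<close> is
  the desired size: an arc of \<open>d + 1\<close> vertices contains at most \<open>\<lceil>(d + 1) m / n\<rceil> \<le> k - 1\<close> of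
  them.\<close>

section \<open>Arcs of consecutive residues\<close>

definition arc :: "nat \<Rightarrow> nat \<Rightarrow> nat \<Rightarrow> nat set" where
  "arc n a l = (\<lambda>j. (a + j) mod n) ` {..<l}"

lemma finite_arc [simp]: "finite (arc n a l)"
  by (simp add: arc_def)

lemma card_arc_le: "card (arc n a l) \<le> l"
  unfolding arc_def using card_image_le[of "{..<l}"] by simp

lemma arc_mono: "l \<le> l' \<Longrightarrow> arc n a l \<subseteq> arc n a l'"
  by (auto simp: arc_def)

lemma inj_on_add_mod: "inj_on (\<lambda>j. (a + j) mod n) {..<n :: nat}"
proof (rule inj_onI)
  \<comment> \<open>Equal residues make \<open>n\<close> divide \<open>j - i\<close>, which is
    smaller than \<open>n\<close> and hence zero. The order \<open>i \<le> j\<close> keeps the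
    subtraction of naturals exact; the other order follows by symmetry.\<close>
  have *: "i = j" if "i \<le> j" "j < n" "(a + i) mod n = (a + j) mod n" for i j :: nat
  proof -
    have "n dvd (a + j) - (a + i)"
      using that by (metis add_le_cancel_left mod_eq_dvd_iff_nat)
    then show ?thesis
      using that by (auto dest: dvd_imp_le)
  qed
  show "x = y" if "x \<in> {..<n}" "y \<in> {..<n}" "(a + x) mod n = (a + y) mod n" for x y
    using *[of x y] *[of y x] that by (metis lessThan_iff nat_le_linear)
qed

lemma bij_betw_add_mod: "bij_betw (\<lambda>j. (a + j) mod n) {..<n} {..<n :: nat}"
  unfolding bij_betw_def using inj_on_add_mod[of a n]
  by (intro conjI endo_inj_surj) auto

lemma card_Int_arc:
  assumes "l \<le> n"
  shows "card (S \<inter> arc n a l) = (\<Sum>j<l. of_bool ((a + j) mod n \<in> S))"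
proof -
  have inj: "inj_on (\<lambda>j. (a + j) mod n) {..<l}"
    using assms by (intro inj_on_subset[OF inj_on_add_mod]) auto
  have "card (S \<inter> arc n a l) = (\<Sum>x\<in>arc n a l. of_bool (x \<in> S))"
    by (simp add: sum.If_cases of_bool_def Int_commute)
  also have "\<dots> = (\<Sum>j<l. of_bool ((a + j) mod n \<in> S))"
    unfolding arc_def by (simp only: sum.reindex[OF inj] o_def)
  finally show ?thesis .
qed

section \<open>Walks and geodesics in the cycle\<close>

lemma edge_cycle_graph_iff:
  "{u, v} \<in> edges (cycle_graph n) \<longleftrightarrow>
    (u < n \<and> v = (u + 1) mod n) \<or> (v < n \<and> u = (v + 1) mod n)"
  by (auto simp: cycle_graph_def doubleton_eq_iff)

text \<open>Each edge moves by +1 or -1 modulo \<open>n\<close>, and \<open>e\<close> is the sum of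
  these signs. This turns a lower bound on path lengths into a question about integers in a residue
  class.\<close>

lemma walk_displacement:
  assumes "p \<noteq> []" and "successively (\<lambda>u v. {u, v} \<in> edges (cycle_graph n)) p"
  shows "\<exists>e. \<bar>e\<bar> \<le> int (path_length p) \<and> int n dvd int (hd p) + e - int (last p)"
  using assms
proof (induction p rule: induct_list012)
  case (3 u v p)
  then obtain e where e: "\<bar>e\<bar> \<le> int (length p)" "int n dvd int v + e - int (last (v # p))"
    by (auto simp: path_length_def)
  have "int n dvd int u + 1 - int v \<or> int n dvd int u - 1 - int v"
  proof -
    have *: "int n dvd int x + 1 - int ((x + 1) mod n)" for x
      by (metis of_nat_1 of_nat_add of_nat_mod dvd_minus_mod)
    have "int n dvd int v + 1 - int u \<longleftrightarrow> int n dvd int u - 1 - int v"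
      by (subst dvd_minus_iff[symmetric]) (simp add: algebra_simps)
    then show ?thesis
      using 3(4) *[of u] *[of v] by (auto simp: edge_cycle_graph_iff)
  qed
  then obtain s where s: "\<bar>s\<bar> = 1" "int n dvd int u + s - int v"
    using that[of 1] that[of "- 1"] by auto
  have "int n dvd int u + (s + e) - int (last (v # p))"
    using dvd_add[OF s(2) e(2)] by (simp add: algebra_simps)
  moreover have "\<bar>s + e\<bar> \<le> int (path_length (u # v # p))"
    using s e by (simp add: path_length_def)
  ultimately show ?case
    by (intro exI[of _ "s + e"]) simp
qed (auto simp: path_length_def)

text \<open>Prepending a vertex to a walk lengthens the covering arc by one position, on the left if
  the walk steps forward from \<open>u\<close> to \<open>v\<close> and on the right if it steps
  backward.\<close>

lemma walk_subset_arc: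
  assumes "p \<noteq> []" and "set p \<subseteq> {..<n}"
    and "successively (\<lambda>u v. {u, v} \<in> edges (cycle_graph n)) p"
  shows "\<exists>a. set p \<subseteq> arc n a (length p)"
  using assms
proof (induction p rule: induct_list012)
  case (2 u)
  then have "set [u] \<subseteq> arc n u (length [u])"
    by (simp add: arc_def)
  then show ?case by blast
next
  case (3 u v p)
  then obtain a where a: "set (v # p) \<subseteq> arc n a (length (v # p))"
    by auto
  then obtain j where j: "j < length (v # p)" "v = (a + j) mod n"
    by (auto simp: arc_def)
  have n: "u < n" "v < n"
    using 3 by auto
  from 3(5) consider "v = (u + 1) mod n" | "u = (v + 1) mod n"
    by (auto simp: edge_cycle_graph_iff)
  then show ?case
  proof cases
    case 1
    \<comment> \<open>The new start \<open>a + (n - 1)\<close> represents a - 1 modulo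
      \<open>n\<close> without truncated subtraction.\<close>
    have shift: "(a + i) mod n = (a + (n - 1) + Suc i) mod n" for i
    proof -
      have "a + (n - 1) + Suc i = a + i + n"
        using n by simp
      then show ?thesis by (simp only: mod_add_self2)
    qed
    have "(u + 1) mod n = ((a + (n - 1) + j) + 1) mod n"
      using 1 j(2) shift[of j] by simp
    then have "(1 + u) mod n = (1 + (a + (n - 1) + j) mod n) mod n"
      by (simp add: mod_simps)
    then have "u = (a + (n - 1) + j) mod n"
      using inj_on_add_mod[of 1 n] n by (auto dest!: inj_onD)
    then have "u \<in> arc n (a + (n - 1)) (length (u # v # p))"
      using j by (auto simp: arc_def)
    moreover have "arc n a (length (v # p)) \<subseteq> arc n (a + (n - 1)) (length (u # v # p))"
    proof
      fix x assume "x \<in> arc n a (length (v # p))"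
      then obtain i where "i < length (v # p)" "x = (a + i) mod n"
        by (auto simp: arc_def)
      then show "x \<in> arc n (a + (n - 1)) (length (u # v # p))"
        unfolding arc_def by (intro image_eqI[of _ _ "Suc i"]) (use shift[of i] in auto)
    qed
    ultimately show ?thesis
      using a by (intro exI[of _ "a + (n - 1)"]) auto
  next
    case 2
    then have "u = (a + Suc j) mod n"
      using j by (simp add: mod_simps)
    then have "u \<in> arc n a (length (u # v # p))"
      unfolding arc_def by (intro image_eqI[of _ _ "Suc j"]) (use j in auto)
    moreover have "arc n a (length (v # p)) \<subseteq> arc n a (length (u # v # p))"
      by (rule arc_mono) simp
    ultimately show ?thesis
      using a by (intro exI[of _ a]) auto
  qed
qed simp

text \<open>A shorter path with the same ends would have a displacement \<open>e\<close> congruent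
  to \<open>d\<close> modulo \<open>n\<close> with |e| < d. Then 0 < d - e < 2d \<le> n, so
  \<open>n\<close> cannot divide d - e; this is where \<open>d \<le> n div 2\<close> enters.\<close>

lemma geodesic_arc:
  assumes "n \<ge> 2" and "d \<le> n div 2"
  shows "geodesic (cycle_graph n) (map (\<lambda>j. (a + j) mod n) [0..<Suc d])"
    (is "geodesic _ ?g")
proof -
  have "distinct ?g"
    using assms by (auto simp: distinct_map simp del: upt_Suc
        intro!: inj_on_subset[OF inj_on_add_mod[of a n]])
  moreover have "successively (\<lambda>u v. {u, v} \<in> edges (cycle_graph n)) ?g"
    unfolding successively_conv_nth using assms
    by (auto simp: edge_cycle_graph_iff mod_simps simp del: upt_Suc)
  ultimately have "path (cycle_graph n) ?g"
    using assms by (auto simp: path_def cycle_graph_def)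
  moreover have "path_length ?g \<le> path_length p"
    if p: "path (cycle_graph n) p" "hd p = hd ?g" "last p = last ?g" for p
  proof (rule ccontr)
    assume "\<not> ?thesis"
    then have less: "path_length p < d"
      by (simp add: path_length_def)
    obtain e where e: "\<bar>e\<bar> \<le> int (path_length p)" "int n dvd int (hd p) + e - int (last p)"
      using walk_displacement[of p n] p by (auto simp: path_def)
    have "hd p = a mod n" "last p = (a + d) mod n"
      using p(2,3) by (simp_all add: hd_map hd_append)
    then have "int n dvd (int a + e - int (a + d))"
      using e(2) by (metis mod_eq_dvd_iff mod_add_left_eq of_nat_mod mod_mod_trivial)
    then have "int n dvd int d - e"
      by (subst dvd_minus_iff[symmetric]) (simp add: algebra_simps)
    moreover have "0 < int d - e" "int d - e < int n"
      using less e(1) assms by auto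
    ultimately show False
      by (auto dest: zdvd_imp_le)
  qed
  ultimately show ?thesis
    by (auto simp: geodesic_def)
qed

lemma general_position_set_cycle_iff:
  assumes "n \<ge> 2" and "d \<le> n div 2"
  shows "general_position_set k d (cycle_graph n) S \<longleftrightarrow>
    S \<subseteq> {..<n} \<and> (\<forall>a. card (S \<inter> arc n a (Suc d)) < k)"
proof (intro iffI conjI allI)
  assume S: "general_position_set k d (cycle_graph n) S"
  then show "S \<subseteq> {..<n}"
    by (auto simp: general_position_set_def cycle_graph_def)
  fix a
  let ?g = "map (\<lambda>j. (a + j) mod n) [0..<Suc d]"
  have "\<not> path_length ?g > d"
    by (simp add: path_length_def)
  then have "card (S \<inter> set ?g) < k"
    using S geodesic_arc[OF assms, of a] unfolding general_position_set_def
    by (meson not_le)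
  moreover have "set ?g = arc n a (Suc d)"
    by (auto simp: arc_def simp del: upt_Suc)
  ultimately show "card (S \<inter> arc n a (Suc d)) < k" by simp
next
  assume S: "S \<subseteq> {..<n} \<and> (\<forall>a. card (S \<inter> arc n a (Suc d)) < k)"
  have "path_length g > d"
    if g: "geodesic (cycle_graph n) g" "card (S \<inter> set g) \<ge> k" for g
  proof (rule ccontr)
    assume "\<not> ?thesis"
    then have len: "length g \<le> Suc d"
      by (simp add: path_length_def)
    obtain a where "set g \<subseteq> arc n a (length g)"
      using walk_subset_arc[of g n] g(1)
      by (auto simp: geodesic_def path_def cycle_graph_def lessThan_atLeast0)
    then have "set g \<subseteq> arc n a (Suc d)"
      using arc_mono[OF len] by blast
    then have "card (S \<inter> set g) \<le> card (S \<inter> arc n a (Suc d))"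
      by (intro card_mono) auto
    then show False
      using S g(2) by (meson not_le order_trans)
  qed
  then show "general_position_set k d (cycle_graph n) S"
    using S by (auto simp: general_position_set_def cycle_graph_def)
qed

section \<open>Double counting over arcs and the balanced set\<close>

lemma sum_card_Int_arc:
  assumes "S \<subseteq> {..<n}" and "l \<le> n"
  shows "(\<Sum>a<n. card (S \<inter> arc n a l)) = l * card S"
proof -
  have "(\<Sum>a<n. card (S \<inter> arc n a l)) = (\<Sum>a<n. \<Sum>j<l. of_bool ((a + j) mod n \<in> S))"
    by (simp add: card_Int_arc[OF assms(2)])
  also have "\<dots> = (\<Sum>j<l. \<Sum>a<n. of_bool ((j + a) mod n \<in> S))"
    by (subst sum.swap) (simp add: add.commute)
  \<comment> \<open>For a fixed offset \<open>j\<close>, translation by \<open>j\<close> permutes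
    the residues, so every offset contributes \<open>card S\<close>.\<close>
  also have "\<dots> = (\<Sum>j<l. \<Sum>x<n. of_bool (x \<in> S))"
    by (intro sum.cong sum.reindex_bij_betw bij_betw_add_mod) simp
  also have "\<dots> = l * card S"
    using assms(1) by (simp add: sum.If_cases of_bool_def Int_absorb1)
  finally show ?thesis .
qed

text \<open>For \<open>m \<le> n\<close> the indicator of this set is the balanced (Christoffel)
  word of slope m/n, which spreads \<open>m\<close> ones as evenly as possible over \<open>n\<close>
  places.\<close>

definition balanced_set :: "nat \<Rightarrow> nat \<Rightarrow> nat set" where
  "balanced_set n m = {i. i < n \<and> i * m div n \<noteq> Suc i * m div n}"

text \<open>Raising \<open>i\<close> by \<open>n\<close> raises \<open>i * m div n\<close> by
  exactly \<open>m\<close>, so the jumps are periodic and \<open>i\<close> need not lie below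
  \<open>n\<close>. Since \<open>m \<le> n\<close>, a jump is 0 or 1 and equals the
  indicator.\<close>

lemma balanced_set_jump:
  assumes "n > 0" and "m \<le> n"
  shows "of_bool (i mod n \<in> balanced_set n m) + i * m div n = Suc i * m div n"
proof -
  define q r where "q = i div n" and "r = i mod n"
  have i: "i = q * n + r"
    by (simp add: q_def r_def)
  have "i * m = r * m + (q * m) * n" "Suc i * m = Suc r * m + (q * m) * n"
    by (simp_all add: i algebra_simps)
  then have "i * m div n = r * m div n + q * m" "Suc i * m div n = Suc r * m div n + q * m"
    using assms(1) by (simp_all del: mult_Suc)
  moreover have "r * m div n \<le> Suc r * m div n"
    by (intro div_le_mono) simp
  moreover have "Suc r * m div n \<le> Suc (r * m div n)"
  proof -
    have "Suc r * m div n \<le> (r * m + n) div n"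
      using assms by (intro div_le_mono) simp
    also have "\<dots> = Suc (r * m div n)"
      using assms(1) by (simp add: div_add_self2)
    finally show ?thesis .
  qed
  moreover have "r < n"
    using assms(1) by (simp add: r_def)
  ultimately show ?thesis
    by (auto simp: balanced_set_def r_def[symmetric] simp del: mult_Suc)
qed

text \<open>The jumps telescope. As \<open>a + j\<close> may exceed \<open>n\<close>, arcs that wrap
  around need no separate case.\<close>

lemma sum_balanced_set:
  assumes "n > 0" and "m \<le> n"
  shows "(\<Sum>j<l. of_bool ((a + j) mod n \<in> balanced_set n m)) + a * m div n = (a + l) * m div n"
proof (induction l)
  case (Suc l)
  then show ?case
    using balanced_set_jump[OF assms, of "a + l"] by (simp del: mult_Suc)
qed simp

lemma card_balanced_set:
  assumes "n > 0" and "m \<le> n"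
  shows "card (balanced_set n m) = m"
proof -
  \<comment> \<open>Over one full period the telescoped sum is \<open>n * m div n\<close>, that is
    \<open>m\<close>.\<close>
  have "(\<Sum>j<n. of_bool ((0 + j) mod n \<in> balanced_set n m)) = m"
    using sum_balanced_set[OF assms, of 0 n] assms(1) by (simp del: sum_of_bool_eq)
  moreover have "balanced_set n m \<inter> arc n 0 n = balanced_set n m"
    by (force simp: balanced_set_def arc_def)
  ultimately show ?thesis
    using card_Int_arc[of n n "balanced_set n m" 0] by (simp only: order_refl)
qed

text \<open>The telescoped count is the difference of the floors of (a + l)m/n and am/n. Since lm/n
  \<le> c with \<open>c\<close> an integer, \<open>c\<close> can be pulled out of the floor.\<close>

lemma card_balanced_set_Int_arc_le:
  assumes "n > 0" and "m \<le> n" and "l \<le> n" and "l * m \<le> c * n"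
  shows "card (balanced_set n m \<inter> arc n a l) \<le> c"
proof -
  have "(a + l) * m div n \<le> (a * m + c * n) div n"
    using assms(4) by (intro div_le_mono) (simp add: algebra_simps)
  also have "\<dots> = a * m div n + c"
    using assms(1) by simp
  finally show ?thesis
    using sum_balanced_set[OF assms(1,2), of a l] card_Int_arc[OF assms(3), of "balanced_set n m" a]
    by linarith
qed

theorem theorem4p6:
  fixes d k n :: nat
  assumes "1 \<le> d" and "d \<le> n div 2"
    and "2 \<le> k" and "k \<le> n div 2 + 1"
  shows "(1 \<le> d \<and> d \<le> k - 2 \<longrightarrow> gp k d (cycle_graph n) = n) \<and>
    (k - 1 \<le> d \<and> d \<le> n div 2 \<longrightarrow> gp k d (cycle_graph n) = ((k - 1) * n) div (d + 1))"
proof -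
  have n: "n \<ge> 2" "Suc d \<le> n" and k: "k > 0"
    using assms by linarith+
  note gps = general_position_set_cycle_iff[OF n(1) assms(2), of k]
  have fin: "finite (verts (cycle_graph n))"
    by (simp add: cycle_graph_def)
  obtain S where "general_position_set k d (cycle_graph n) S"
    and card_S: "card S = gp k d (cycle_graph n)"
    using gp_attained(1)[OF fin k] by blast
  then have S: "S \<subseteq> {..<n}" "card (S \<inter> arc n a (Suc d)) < k" for a
    by (simp_all only: gps)
  have lower: "card T \<le> gp k d (cycle_graph n)"
    if "T \<subseteq> {..<n}" "\<And>a. card (T \<inter> arc n a (Suc d)) < k" for T
    using that by (intro gp_attained(2)[OF fin k]) (simp add: gps)
  have "gp k d (cycle_graph n) = n" if "d \<le> k - 2"
  proof (rule antisym)
    show "gp k d (cycle_graph n) \<le> n"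
      using card_mono[OF _ S(1)] card_S by simp
    \<comment> \<open>An arc has at most d + 1 \<le> k - 1 vertices, so even the whole vertex set is
      admissible.\<close>
    have "card ({..<n} \<inter> arc n a (Suc d)) < k" for a
    proof -
      have "card ({..<n} \<inter> arc n a (Suc d)) \<le> card (arc n a (Suc d))"
        by (intro card_mono) auto
      then show ?thesis
        using card_arc_le[of n a "Suc d"] that assms(3) by linarith
    qed
    then show "n \<le> gp k d (cycle_graph n)"
      using lower[of "{..<n}"] by simp
  qed
  moreover have "gp k d (cycle_graph n) = ((k - 1) * n) div (d + 1)" if "k - 1 \<le> d"
  proof (rule antisym)
    have "card S * Suc d = (\<Sum>a<n. card (S \<inter> arc n a (Suc d)))"
      using sum_card_Int_arc[OF S(1) n(2)] by (simp add: mult.commute)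
    also have "\<dots> \<le> (\<Sum>a<n. k - 1)"
      using S(2) by (intro sum_mono) (metis Suc_pred' k less_Suc_eq_le)
    also have "\<dots> = (k - 1) * n" by simp
    finally show "gp k d (cycle_graph n) \<le> ((k - 1) * n) div (d + 1)"
      using card_S by (simp add: less_eq_div_iff_mult_less_eq)
  next
    \<comment> \<open>The largest \<open>m\<close> with (d + 1)m \<le> (k - 1)n, which is the
      hypothesis of the arc bound for l = d + 1 and c = k - 1.\<close>
    define m where "m = ((k - 1) * n) div (d + 1)"
    have m: "Suc d * m \<le> (k - 1) * n"
      unfolding m_def using times_div_less_eq_dividend[of "d + 1"] by simp
    \<comment> \<open>The case assumption \<open>k - 1 \<le> d\<close> ensures that \<open>m\<close>
      does not exceed \<open>n\<close>, so a balanced set of size \<open>m\<close> exists.\<close>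
    have "(k - 1) * n \<le> Suc d * n"
      using that by (intro mult_le_mono1) simp
    then have "m \<le> n"
      using m by (meson Suc_mult_le_cancel1 order_trans)
    then have "card (balanced_set n m \<inter> arc n a (Suc d)) < k" for a
      using card_balanced_set_Int_arc_le[OF _ _ n(2) m, of a] n k by (simp add: less_eq_Suc_le)
    moreover have "balanced_set n m \<subseteq> {..<n}"
      by (auto simp: balanced_set_def)
    ultimately show "((k - 1) * n) div (d + 1) \<le> gp k d (cycle_graph n)"
      using lower[of "balanced_set n m"] card_balanced_set[of n m] \<open>m \<le> n\<close> n
      by (simp add: m_def)
  qed
  ultimately show ?thesis by blast
qed

end
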